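(* Let $(A,\prec,\succ,\alpha,\beta)$ be a BiHom-pre-alternative algebra and $R:A\to A$ a Rota-Baxter operator of weight $0$ on $A$. Define, for $x,y\in A$, $$x\searrow_R y=R(x)\succ y,\quad x\nearrow_R y=x\succ R(y),\quad x\swarrow_R y=R(x)\prec y,\quad x\nwarrow_R y=x\prec R(y).$$ Then $(A,\nwarrow_R,\swarrow_R,\nearrow_R,\searrow_R,\alpha,\beta)$ is a BiHom-alternative quadri-algebra.
   Context: $\mathbb K$ is a field of characteristic $0$; all vector spaces are over $\mathbb K$. A BiHom-pre-alternative algebra is a tuple $(A,\prec,\succ,\alpha,\beta)$ with $A$ a vector space, $\prec,\succ:A\times A\to A$ bilinear, $\alpha,\beta:A\to A$ commuting linear maps, each multiplicative for both $\prec$ and $\succ$, such that, writing $x\circ y=x\prec y+x\succ y$ and $as^r_{\alpha,\beta}(x,y,z)=(x\prec y)\prec\beta(z)-\alpha(x)\prec(y\circ z)$, $as^m_{\alpha,\beta}(x,y,z)=(x\succ y)\prec\beta(z)-\alpha(x)\succ(y\prec z)$, $as^l_{\alpha,\beta}(x,y,z)=(x\circ y)\succ\beta(z)-\alpha(x)\succ(y\succ z)$, for all $x,y,z\in A$: - $as^r_{\alpha,\beta}(x,\beta(y),\alpha(z))+as^r_{\alpha,\beta}(x,\beta(z),\alpha(y))=0$; - $as^l_{\alpha,\beta}(\beta(x),\alpha(y),z)+as^l_{\alpha,\beta}(\beta(y),\alpha(x),z)=0$; - $as^m_{\alpha,\beta}(\beta(x),\alpha(y),z)+as^r_{\alpha,\beta}(\beta(y),\alpha(x),z)=0$;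 - $as^m_{\alpha,\beta}(x,\beta(y),\alpha(z))+as^l_{\alpha,\beta}(x,\beta(z),\alpha(y))=0$. A Rota-Baxter operator of weight $0$ on a BiHom-pre-alternative algebra $(A,\prec,\succ,\alpha,\beta)$ is a linear map $R:A\to A$ with $R\alpha=\alpha R$, $R\beta=\beta R$, and for all $x,y\in A$: $R(x)\succ R(y)=R(x\succ R(y)+R(x)\succ y)$ and $R(x)\prec R(y)=R(x\prec R(y)+R(x)\prec y)$. A BiHom-alternative quadri-algebra is a tuple $(A,\nwarrow,\swarrow,\nearrow,\searrow,\alpha,\beta)$ with $A$ a vector space, four bilinear operations $A\times A\to A$, and two commuting linear maps $\alpha,\beta:A\to A$ multiplicative for all four operations, such that, with $\succ,\prec,\vee,\wedge,\ast$ defined by $x\succ y=x\nearrow y+x\searrow y$, $x\prec y=x\nwarrow y+x\swarrow y$, $x\vee y=x\searrow y+x\swarrow y$, $x\wedge y=x\nearrow y+x\nwarrow y$, $x\ast y=x\searrow y+x\nearrow y+x\swarrow y+x\nwarrow y$, and (dropping subscripts $\alpha,\beta$) $\{x,y,z\}^r=(x\nwarrow y)\nwarrow\beta(z)-\alpha(x)\nwarrow(y\ast z)$, $\{x,y,z\}^l=(x\ast y)\searrow\beta(z)-\alpha(x)\searrow(y\searrow z)$, $\{x,y,z\}^{ne}=(x\wedge y)\nearrow\beta(z)-\alpha(x)\nearrow(y\succ z)$, $\{x,y,z\}^{sw}=(x\prec y)\swarrow\beta(z)-\alpha(x)\swarrow(y\vee z)$, $\{x,y,z\}^n=(x\nearrow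 y)\nwarrow\beta(z)-\alpha(x)\nearrow(y\prec z)$, $\{x,y,z\}^w=(x\swarrow y)\nwarrow\beta(z)-\alpha(x)\swarrow(y\wedge z)$, $\{x,y,z\}^s=(x\succ y)\swarrow\beta(z)-\alpha(x)\searrow(y\swarrow z)$, $\{x,y,z\}^e=(x\vee y)\nearrow\beta(z)-\alpha(x)\searrow(y\nearrow z)$, $\{x,y,z\}^m=(x\searrow y)\nwarrow\beta(z)-\alpha(x)\searrow(y\nwarrow z)$, for all $x,y,z\in A$: - $\{\beta(x),\alpha(y),z\}^p+\{\beta(y),\alpha(x),z\}^q=0$ for $(p,q)\in\{(r,m),(n,w),(ne,e),(sw,s),(l,l)\}$; - $\{x,\beta(y),\alpha(z)\}^p+\{x,\beta(z),\alpha(y)\}^q=0$ for $(p,q)\in\{(r,r),(n,ne),(w,sw),(m,l),(s,e)\}$. (In this definition $\prec,\succ$ are built from the four arrows of the quadri-algebra; they are not the given operations of the BiHom-pre-alternative algebra in the claim.) *)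

theory Defs
  imports Complex_Main
begin

text \<open>
  Vector spaces are given by the library locale \<^locale>\<open>vector_space\<close>; the underlying space is
  the whole type \<open>'v\<close>. Characteristic \<open>0\<close> of the ground field is the class
  \<^class>\<open>field_char_0\<close>.
\<close>

definition bilinear_op ::
    "('k::field_char_0 \<Rightarrow> 'v::ab_group_add \<Rightarrow> 'v) \<Rightarrow> ('v \<Rightarrow> 'v \<Rightarrow> 'v) \<Rightarrow> bool" where
  "bilinear_op scale f \<longleftrightarrow>
     (\<forall>x. Vector_Spaces.linear scale scale (\<lambda>y. f x y)) \<and>
     (\<forall>y. Vector_Spaces.linear scale scale (\<lambda>x. f x y))"

definition multiplicative_for :: "('v \<Rightarrow> 'v) \<Rightarrow> ('v \<Rightarrow> 'v \<Rightarrow> 'v) \<Rightarrow> bool" where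
  "multiplicative_for \<phi> f \<longleftrightarrow> (\<forall>x y. \<phi> (f x y) = f (\<phi> x) (\<phi> y))"

locale commuting_linear_maps = vector_space scale
  for scale :: "'k::field_char_0 \<Rightarrow> 'v::ab_group_add \<Rightarrow> 'v" +
  fixes \<alpha> \<beta> :: "'v \<Rightarrow> 'v"
  assumes linear_\<alpha>: "Vector_Spaces.linear scale scale \<alpha>"
    and linear_\<beta>: "Vector_Spaces.linear scale scale \<beta>"
    and \<alpha>_\<beta>_commute: "\<alpha> (\<beta> x) = \<beta> (\<alpha> x)"

locale bihom_two_operations = commuting_linear_maps scale \<alpha> \<beta>
  for scale :: "'k::field_char_0 \<Rightarrow> 'v::ab_group_add \<Rightarrow> 'v"
    and prec :: "'v \<Rightarrow> 'v \<Rightarrow> 'v" (infixl "\<prec>" 70)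
    and succ :: "'v \<Rightarrow> 'v \<Rightarrow> 'v" (infixl "\<succ>" 70)
    and \<alpha> \<beta> :: "'v \<Rightarrow> 'v" +
  assumes bilinear_prec: "bilinear_op scale (\<prec>)"
    and bilinear_succ: "bilinear_op scale (\<succ>)"
    and \<alpha>_prec: "multiplicative_for \<alpha> (\<prec>)"
    and \<alpha>_succ: "multiplicative_for \<alpha> (\<succ>)"
    and \<beta>_prec: "multiplicative_for \<beta> (\<prec>)"
    and \<beta>_succ: "multiplicative_for \<beta> (\<succ>)"
begin

definition circ :: "'v \<Rightarrow> 'v \<Rightarrow> 'v" (infixl "\<odot>" 70) where
  "x \<odot> y = x \<prec> y + x \<succ> y"

definition as_r :: "'v \<Rightarrow> 'v \<Rightarrow> 'v \<Rightarrow> 'v" where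
  "as_r x y z = (x \<prec> y) \<prec> \<beta> z - \<alpha> x \<prec> (y \<odot> z)"

definition as_m :: "'v \<Rightarrow> 'v \<Rightarrow> 'v \<Rightarrow> 'v" where
  "as_m x y z = (x \<succ> y) \<prec> \<beta> z - \<alpha> x \<succ> (y \<prec> z)"

definition as_l :: "'v \<Rightarrow> 'v \<Rightarrow> 'v \<Rightarrow> 'v" where
  "as_l x y z = (x \<odot> y) \<succ> \<beta> z - \<alpha> x \<succ> (y \<succ> z)"

end

locale bihom_pre_alternative_algebra = bihom_two_operations scale prec succ \<alpha> \<beta>
  for scale :: "'k::field_char_0 \<Rightarrow> 'v::ab_group_add \<Rightarrow> 'v"
    and prec :: "'v \<Rightarrow> 'v \<Rightarrow> 'v" (infixl "\<prec>" 70)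
    and succ :: "'v \<Rightarrow> 'v \<Rightarrow> 'v" (infixl "\<succ>" 70)
    and \<alpha> \<beta> :: "'v \<Rightarrow> 'v" +
  assumes as_rr: "as_r x (\<beta> y) (\<alpha> z) + as_r x (\<beta> z) (\<alpha> y) = 0"
    and as_ll: "as_l (\<beta> x) (\<alpha> y) z + as_l (\<beta> y) (\<alpha> x) z = 0"
    and as_mr: "as_m (\<beta> x) (\<alpha> y) z + as_r (\<beta> y) (\<alpha> x) z = 0"
    and as_ml: "as_m x (\<beta> y) (\<alpha> z) + as_l x (\<beta> z) (\<alpha> y) = 0"
begin

definition rota_baxter_operator_0 :: "('v \<Rightarrow> 'v) \<Rightarrow> bool" where
  "rota_baxter_operator_0 R \<longleftrightarrow>
     Vector_Spaces.linear scale scale R \<and>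
     R \<circ> \<alpha> = \<alpha> \<circ> R \<and>
     R \<circ> \<beta> = \<beta> \<circ> R \<and>
     (\<forall>x y. R x \<succ> R y = R (x \<succ> R y + R x \<succ> y)) \<and>
     (\<forall>x y. R x \<prec> R y = R (x \<prec> R y + R x \<prec> y))"

end

text \<open>
  The operations \<open>nw\<close>, \<open>sw\<close>, \<open>ne\<close>, \<open>se\<close> are the ones usually written as
  north-west, south-west, north-east and south-east arrows.
\<close>

locale bihom_four_operations = commuting_linear_maps scale \<alpha> \<beta>
  for scale :: "'k::field_char_0 \<Rightarrow> 'v::ab_group_add \<Rightarrow> 'v"
    and nw :: "'v \<Rightarrow> 'v \<Rightarrow> 'v" (infixl "\<cdot>\<^bsub>nw\<^esub>" 70)
    and sw :: "'v \<Rightarrow> 'v \<Rightarrow> 'v" (infixl "\<cdot>\<^bsub>sw\<^esub>" 70)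
    and ne :: "'v \<Rightarrow> 'v \<Rightarrow> 'v" (infixl "\<cdot>\<^bsub>ne\<^esub>" 70)
    and se :: "'v \<Rightarrow> 'v \<Rightarrow> 'v" (infixl "\<cdot>\<^bsub>se\<^esub>" 70)
    and \<alpha> \<beta> :: "'v \<Rightarrow> 'v" +
  assumes bilinear_nw: "bilinear_op scale (\<cdot>\<^bsub>nw\<^esub>)"
    and bilinear_sw: "bilinear_op scale (\<cdot>\<^bsub>sw\<^esub>)"
    and bilinear_ne: "bilinear_op scale (\<cdot>\<^bsub>ne\<^esub>)"
    and bilinear_se: "bilinear_op scale (\<cdot>\<^bsub>se\<^esub>)"
    and \<alpha>_nw: "multiplicative_for \<alpha> (\<cdot>\<^bsub>nw\<^esub>)"
    and \<alpha>_sw: "multiplicative_for \<alpha> (\<cdot>\<^bsub>sw\<^esub>)"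
    and \<alpha>_ne: "multiplicative_for \<alpha> (\<cdot>\<^bsub>ne\<^esub>)"
    and \<alpha>_se: "multiplicative_for \<alpha> (\<cdot>\<^bsub>se\<^esub>)"
    and \<beta>_nw: "multiplicative_for \<beta> (\<cdot>\<^bsub>nw\<^esub>)"
    and \<beta>_sw: "multiplicative_for \<beta> (\<cdot>\<^bsub>sw\<^esub>)"
    and \<beta>_ne: "multiplicative_for \<beta> (\<cdot>\<^bsub>ne\<^esub>)"
    and \<beta>_se: "multiplicative_for \<beta> (\<cdot>\<^bsub>se\<^esub>)"
begin

definition quad_succ :: "'v \<Rightarrow> 'v \<Rightarrow> 'v" (infixl "\<succ>\<^sub>Q" 70) where
  "x \<succ>\<^sub>Q y = x \<cdot>\<^bsub>ne\<^esub> y + x \<cdot>\<^bsub>se\<^esub> y"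

definition quad_prec :: "'v \<Rightarrow> 'v \<Rightarrow> 'v" (infixl "\<prec>\<^sub>Q" 70) where
  "x \<prec>\<^sub>Q y = x \<cdot>\<^bsub>nw\<^esub> y + x \<cdot>\<^bsub>sw\<^esub> y"

definition quad_vee :: "'v \<Rightarrow> 'v \<Rightarrow> 'v" (infixl "\<or>\<^sub>Q" 70) where
  "x \<or>\<^sub>Q y = x \<cdot>\<^bsub>se\<^esub> y + x \<cdot>\<^bsub>sw\<^esub> y"

definition quad_wedge :: "'v \<Rightarrow> 'v \<Rightarrow> 'v" (infixl "\<and>\<^sub>Q" 70) where
  "x \<and>\<^sub>Q y = x \<cdot>\<^bsub>ne\<^esub> y + x \<cdot>\<^bsub>nw\<^esub> y"

definition quad_ast :: "'v \<Rightarrow> 'v \<Rightarrow> 'v" (infixl "\<star>\<^sub>Q" 70) where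
  "x \<star>\<^sub>Q y = x \<cdot>\<^bsub>se\<^esub> y + x \<cdot>\<^bsub>ne\<^esub> y + x \<cdot>\<^bsub>sw\<^esub> y + x \<cdot>\<^bsub>nw\<^esub> y"

definition quad_r :: "'v \<Rightarrow> 'v \<Rightarrow> 'v \<Rightarrow> 'v" where
  "quad_r x y z = (x \<cdot>\<^bsub>nw\<^esub> y) \<cdot>\<^bsub>nw\<^esub> \<beta> z - \<alpha> x \<cdot>\<^bsub>nw\<^esub> (y \<star>\<^sub>Q z)"

definition quad_l :: "'v \<Rightarrow> 'v \<Rightarrow> 'v \<Rightarrow> 'v" where
  "quad_l x y z = (x \<star>\<^sub>Q y) \<cdot>\<^bsub>se\<^esub> \<beta> z - \<alpha> x \<cdot>\<^bsub>se\<^esub> (y \<cdot>\<^bsub>se\<^esub> z)"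

definition quad_ne :: "'v \<Rightarrow> 'v \<Rightarrow> 'v \<Rightarrow> 'v" where
  "quad_ne x y z = (x \<and>\<^sub>Q y) \<cdot>\<^bsub>ne\<^esub> \<beta> z - \<alpha> x \<cdot>\<^bsub>ne\<^esub> (y \<succ>\<^sub>Q z)"

definition quad_sw :: "'v \<Rightarrow> 'v \<Rightarrow> 'v \<Rightarrow> 'v" where
  "quad_sw x y z = (x \<prec>\<^sub>Q y) \<cdot>\<^bsub>sw\<^esub> \<beta> z - \<alpha> x \<cdot>\<^bsub>sw\<^esub> (y \<or>\<^sub>Q z)"

definition quad_n :: "'v \<Rightarrow> 'v \<Rightarrow> 'v \<Rightarrow> 'v" where
  "quad_n x y z = (x \<cdot>\<^bsub>ne\<^esub> y) \<cdot>\<^bsub>nw\<^esub> \<beta> z - \<alpha> x \<cdot>\<^bsub>ne\<^esub> (y \<prec>\<^sub>Q z)"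

definition quad_w :: "'v \<Rightarrow> 'v \<Rightarrow> 'v \<Rightarrow> 'v" where
  "quad_w x y z = (x \<cdot>\<^bsub>sw\<^esub> y) \<cdot>\<^bsub>nw\<^esub> \<beta> z - \<alpha> x \<cdot>\<^bsub>sw\<^esub> (y \<and>\<^sub>Q z)"

definition quad_s :: "'v \<Rightarrow> 'v \<Rightarrow> 'v \<Rightarrow> 'v" where
  "quad_s x y z = (x \<succ>\<^sub>Q y) \<cdot>\<^bsub>sw\<^esub> \<beta> z - \<alpha> x \<cdot>\<^bsub>se\<^esub> (y \<cdot>\<^bsub>sw\<^esub> z)"

definition quad_e :: "'v \<Rightarrow> 'v \<Rightarrow> 'v \<Rightarrow> 'v" where
  "quad_e x y z = (x \<or>\<^sub>Q y) \<cdot>\<^bsub>ne\<^esub> \<beta> z - \<alpha> x \<cdot>\<^bsub>se\<^esub> (y \<cdot>\<^bsub>ne\<^esub> z)"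

definition quad_m :: "'v \<Rightarrow> 'v \<Rightarrow> 'v \<Rightarrow> 'v" where
  "quad_m x y z = (x \<cdot>\<^bsub>se\<^esub> y) \<cdot>\<^bsub>nw\<^esub> \<beta> z - \<alpha> x \<cdot>\<^bsub>se\<^esub> (y \<cdot>\<^bsub>nw\<^esub> z)"

end

locale bihom_alternative_quadri_algebra = bihom_four_operations scale nw sw ne se \<alpha> \<beta>
  for scale :: "'k::field_char_0 \<Rightarrow> 'v::ab_group_add \<Rightarrow> 'v"
    and nw :: "'v \<Rightarrow> 'v \<Rightarrow> 'v" (infixl "\<cdot>\<^bsub>nw\<^esub>" 70)
    and sw :: "'v \<Rightarrow> 'v \<Rightarrow> 'v" (infixl "\<cdot>\<^bsub>sw\<^esub>" 70)
    and ne :: "'v \<Rightarrow> 'v \<Rightarrow> 'v" (infixl "\<cdot>\<^bsub>ne\<^esub>" 70)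
    and se :: "'v \<Rightarrow> 'v \<Rightarrow> 'v" (infixl "\<cdot>\<^bsub>se\<^esub>" 70)
    and \<alpha> \<beta> :: "'v \<Rightarrow> 'v" +
  assumes left_r_m: "quad_r (\<beta> x) (\<alpha> y) z + quad_m (\<beta> y) (\<alpha> x) z = 0"
    and left_n_w: "quad_n (\<beta> x) (\<alpha> y) z + quad_w (\<beta> y) (\<alpha> x) z = 0"
    and left_ne_e: "quad_ne (\<beta> x) (\<alpha> y) z + quad_e (\<beta> y) (\<alpha> x) z = 0"
    and left_sw_s: "quad_sw (\<beta> x) (\<alpha> y) z + quad_s (\<beta> y) (\<alpha> x) z = 0"
    and left_l_l: "quad_l (\<beta> x) (\<alpha> y) z + quad_l (\<beta> y) (\<alpha> x) z = 0"
    and right_r_r: "quad_r x (\<beta> y) (\<alpha> z) + quad_r x (\<beta> z) (\<alpha> y) = 0"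
    and right_n_ne: "quad_n x (\<beta> y) (\<alpha> z) + quad_ne x (\<beta> z) (\<alpha> y) = 0"
    and right_w_sw: "quad_w x (\<beta> y) (\<alpha> z) + quad_sw x (\<beta> z) (\<alpha> y) = 0"
    and right_m_l: "quad_m x (\<beta> y) (\<alpha> z) + quad_l x (\<beta> z) (\<alpha> y) = 0"
    and right_s_e: "quad_s x (\<beta> y) (\<alpha> z) + quad_e x (\<beta> z) (\<alpha> y) = 0"

end

theory Submission
  imports Defs
begin

text \<open>
  The operator \<open>R\<close> relates the two structures through their associators. Each of the four arrow
  operations is \<open>\<prec>\<close> or \<open>\<succ>\<close> with \<open>R\<close> inserted in one of the two arguments, so a product of three
  elements carries \<open>R\<close> on exactly two of them. When the inner product already has \<open>R\<close> on one factor
  and stands in the slot without \<open>R\<close>, nothing has to be done. When it stands in the slot with \<open>R\<close>,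
  the operations collected in \<open>*\<close>, or in the quadri-algebra's own \<open>\<succ>\<close> and \<open>\<prec>\<close>, are exactly the ones
  that the Rota-Baxter identity turns into a single product of two \<open>R\<close>-images. Consequently every
  one of the nine associators of the arrows is an associator of \<open>\<prec>\<close> and \<open>\<succ>\<close> with \<open>R\<close> applied to two
  of its three arguments:

  \<^item> \<open>R\<close> on the second and third argument: \<open>as_r\<close>, \<open>as_m\<close>, \<open>as_l\<close> become the \<open>r\<close>, \<open>n\<close>, \<open>ne\<close> ones;
  \<^item> \<open>R\<close> on the first and third argument: \<open>as_r\<close>, \<open>as_m\<close>, \<open>as_l\<close> become the \<open>w\<close>, \<open>m\<close>, \<open>e\<close> ones;
  \<^item> \<open>R\<close> on the first and second argument: \<open>as_r\<close>, \<open>as_m\<close>, \<open>as_l\<close> become the \<open>sw\<close>, \<open>s\<close>, \<open>l\<close> ones.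

  Since \<open>R\<close> commutes with \<open>\<alpha>\<close> and \<open>\<beta>\<close>, the pre-alternative identities may be evaluated with two of
  the variables replaced by their \<open>R\<close>-images, in three ways each. For the identities linking
  \<open>as_m\<close> with \<open>as_r\<close> or with \<open>as_l\<close> the three results differ; for those linking \<open>as_r\<close> or \<open>as_l\<close>
  with itself, two of the three agree up to exchanging variables. This gives the \<open>3 + 3 + 2 + 2\<close>
  quadri-algebra identities.
\<close>

lemma bilinear_op_precompose:
  assumes "bilinear_op scale f" and "Vector_Spaces.linear scale scale R"
  shows "bilinear_op scale (\<lambda>x y. f x (R y))" and "bilinear_op scale (\<lambda>x y. f (R x) y)"
  using assms Vector_Spaces.linear_compose[of scale scale R scale]
  unfolding bilinear_op_def comp_def by blast+

lemma multiplicative_for_precompose: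
  assumes "multiplicative_for \<phi> f" and "R \<circ> \<phi> = \<phi> \<circ> R"
  shows "multiplicative_for \<phi> (\<lambda>x y. f x (R y))" and "multiplicative_for \<phi> (\<lambda>x y. f (R x) y)"
  using assms unfolding multiplicative_for_def fun_eq_iff by simp_all

locale rota_baxter_bihom_pre_alternative_algebra =
  bihom_pre_alternative_algebra scale prec succ \<alpha> \<beta>
  for scale :: "'k::field_char_0 \<Rightarrow> 'v::ab_group_add \<Rightarrow> 'v"
    and prec :: "'v \<Rightarrow> 'v \<Rightarrow> 'v" (infixl "\<prec>" 70)
    and succ :: "'v \<Rightarrow> 'v \<Rightarrow> 'v" (infixl "\<succ>" 70)
    and \<alpha> \<beta> :: "'v \<Rightarrow> 'v" +
  fixes R :: "'v \<Rightarrow> 'v"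
  assumes rota_baxter: "rota_baxter_operator_0 R"
begin

lemma linear_R: "Vector_Spaces.linear scale scale R"
  and R_comp_\<alpha>: "R \<circ> \<alpha> = \<alpha> \<circ> R"
  and R_comp_\<beta>: "R \<circ> \<beta> = \<beta> \<circ> R"
  and R_succ: "R (x \<succ> R y + R x \<succ> y) = R x \<succ> R y"
  and R_prec: "R (x \<prec> R y + R x \<prec> y) = R x \<prec> R y"
  using rota_baxter unfolding rota_baxter_operator_0_def by auto

lemma R_\<alpha>: "R (\<alpha> x) = \<alpha> (R x)"
  and R_\<beta>: "R (\<beta> x) = \<beta> (R x)"
  using R_comp_\<alpha> R_comp_\<beta> by (simp_all add: fun_eq_iff)

text \<open>
  The sum of the two Rota-Baxter identities; the summands stand in the order of the total
  product of the quadri-algebra.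
\<close>

lemma R_circ: "R (R x \<succ> y + x \<succ> R y + R x \<prec> y + x \<prec> R y) = R x \<odot> R y"
proof -
  have "R x \<succ> y + x \<succ> R y + R x \<prec> y + x \<prec> R y
      = (x \<prec> R y + R x \<prec> y) + (x \<succ> R y + R x \<succ> y)"
    by (simp add: algebra_simps)
  moreover have "R (u + v) = R u + R v" for u v
    using linear_R[THEN Vector_Spaces.linear.axioms(3)] by (rule module_hom.add)
  ultimately show ?thesis
    unfolding circ_def R_prec[of x y, symmetric] R_succ[of x y, symmetric] by (simp only:)
qed

sublocale quadri: bihom_four_operations scale
  "\<lambda>x y. x \<prec> R y" "\<lambda>x y. R x \<prec> y" "\<lambda>x y. x \<succ> R y" "\<lambda>x y. R x \<succ> y" \<alpha> \<beta>
  by (unfold_locales;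
    rule bilinear_op_precompose[OF bilinear_prec linear_R]
      bilinear_op_precompose[OF bilinear_succ linear_R]
      multiplicative_for_precompose[OF \<alpha>_prec R_comp_\<alpha>]
      multiplicative_for_precompose[OF \<alpha>_succ R_comp_\<alpha>]
      multiplicative_for_precompose[OF \<beta>_prec R_comp_\<beta>]
      multiplicative_for_precompose[OF \<beta>_succ R_comp_\<beta>])

lemmas quadri_operation_defs =
  quadri.quad_succ_def quadri.quad_prec_def quadri.quad_vee_def quadri.quad_wedge_def
  quadri.quad_ast_def

lemma quad_r_eq: "quadri.quad_r x y z = as_r x (R y) (R z)"
  unfolding quadri.quad_r_def as_r_def quadri_operation_defs by (simp only: R_circ R_\<beta>)

lemma quad_n_eq: "quadri.quad_n x y z = as_m x (R y) (R z)"
  unfolding quadri.quad_n_def as_m_def quadri_operation_defs by (simp only: R_prec R_\<beta>)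

lemma quad_ne_eq: "quadri.quad_ne x y z = as_l x (R y) (R z)"
  unfolding quadri.quad_ne_def as_l_def circ_def quadri_operation_defs
  by (simp only: R_succ R_\<beta> add.commute)

lemma quad_w_eq: "quadri.quad_w x y z = as_r (R x) y (R z)"
  unfolding quadri.quad_w_def as_r_def circ_def quadri_operation_defs
  by (simp only: R_\<alpha> R_\<beta> add.commute)

lemma quad_m_eq: "quadri.quad_m x y z = as_m (R x) y (R z)"
  unfolding quadri.quad_m_def as_m_def by (simp only: R_\<alpha> R_\<beta>)

lemma quad_e_eq: "quadri.quad_e x y z = as_l (R x) y (R z)"
  unfolding quadri.quad_e_def as_l_def circ_def quadri_operation_defs
  by (simp only: R_\<alpha> R_\<beta> add.commute)

lemma quad_sw_eq: "quadri.quad_sw x y z = as_r (R x) (R y) z"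
  unfolding quadri.quad_sw_def as_r_def circ_def quadri_operation_defs
  by (simp only: R_prec R_\<alpha> add.commute)

lemma quad_s_eq: "quadri.quad_s x y z = as_m (R x) (R y) z"
  unfolding quadri.quad_s_def as_m_def quadri_operation_defs by (simp only: R_succ R_\<alpha>)

lemma quad_l_eq: "quadri.quad_l x y z = as_l (R x) (R y) z"
  unfolding quadri.quad_l_def as_l_def quadri_operation_defs by (simp only: R_circ R_\<alpha>)

lemmas quad_associator_eqs =
  quad_r_eq quad_n_eq quad_ne_eq quad_w_eq quad_m_eq quad_e_eq quad_sw_eq quad_s_eq quad_l_eq

text \<open>
  The identity linking \<open>as_m\<close> and \<open>as_r\<close> is needed with either associator first, because the
  \<open>(r, m)\<close> and \<open>(sw, s)\<close> identities list them in the order opposite to \<open>(n, w)\<close>.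
\<close>

lemma as_rm: "as_r (\<beta> x) (\<alpha> y) z + as_m (\<beta> y) (\<alpha> x) z = 0"
  using as_mr[of y x z] by (simp add: add.commute)

lemma alternative_quadri_algebra:
  "bihom_alternative_quadri_algebra scale
     (\<lambda>x y. x \<prec> R y) (\<lambda>x y. R x \<prec> y) (\<lambda>x y. x \<succ> R y) (\<lambda>x y. R x \<succ> y) \<alpha> \<beta>"
  by unfold_locales
    (simp_all only: quad_associator_eqs R_\<alpha> R_\<beta> as_rr as_ll as_mr as_ml as_rm)

end

theorem corollary2p2:
  fixes scale :: "'k::field_char_0 \<Rightarrow> 'v::ab_group_add \<Rightarrow> 'v"
    and prec :: "'v \<Rightarrow> 'v \<Rightarrow> 'v" (infixl "\<prec>" 70)
    and succ :: "'v \<Rightarrow> 'v \<Rightarrow> 'v" (infixl "\<succ>" 70)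
    and \<alpha> \<beta> R :: "'v \<Rightarrow> 'v"
  assumes "bihom_pre_alternative_algebra scale (\<prec>) (\<succ>) \<alpha> \<beta>"
    and "bihom_pre_alternative_algebra.rota_baxter_operator_0 scale (\<prec>) (\<succ>) \<alpha> \<beta> R"
  shows "bihom_alternative_quadri_algebra scale
           (\<lambda>x y. x \<prec> R y)
           (\<lambda>x y. R x \<prec> y)
           (\<lambda>x y. x \<succ> R y)
           (\<lambda>x y. R x \<succ> y)
           \<alpha> \<beta>"
  using assms
  by (intro rota_baxter_bihom_pre_alternative_algebra.alternative_quadri_algebra
      rota_baxter_bihom_pre_alternative_algebra.intro
      rota_baxter_bihom_pre_alternative_algebra_axioms.intro)

end
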